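(* The function $\widehat\Gamma_{\rm d}$ increases monotonically with respect to $P_{\rm s}$ for any $d$, and, for any feasible $d$ (that is, $\sqrt{\delta^2-y^2}\le d\le d_{\rm sd}-\sqrt{\delta^2-y^2}$), the optimal solution of the power allocation problem $$\max_{P_{\rm s}}\ \widehat\Gamma_{\rm d}(P_{\rm s},d)\quad\text{subject to}\quad P_{\rm s}\,\mathbb{E}[|h_{\rm sc}|^2]\le I^{\rm th},\quad 0\le P_{\rm s}\le P_{\rm s}^{\max}$$ is $$P_{\rm s}^\star=\min\left\{P_{\rm s}^{\max},\ P_{\rm s}^{\rm ub}\right\},\qquad P_{\rm s}^{\rm ub}=\frac{I^{\rm th}}{\mathbb{E}[|h_{\rm sc}|^2]}.$$
   Context: A device-to-device (D2D) source transmits with power $P_{\rm s}$ to a D2D receiver at distance $d_{\rm sd}$, over a direct channel and via a reconfigurable intelligent surface (RIS) with $N$ reflecting elements of common amplitude $\alpha\in[0,1]$. The RIS lies on a line parallel to the source-receiver segment, at offset $y$ from it, and $d$ is its coordinate along that line measured from the source. An $M$-antenna base station with transmit power $P_{\rm b}$ interferes with the D2D receiver. $N,M\ge1$ are integers; $d_0$ (reference distance), $\eta$ (path loss exponent), $\delta$ (smallest allowed distance between the RIS and the D2D source or receiver), $N_0$ (noise variance), $\beta_{\rm bd}$ (mean gain of the channel from base station to D2D receiver), $P_{\rm s}^{\max}$ (source power budget) and $I^{\rm th}$ (interference threshold) are positive constants, and $0\le y\le\delta$. $\mathbb{E}[|h_{\rm sc}|^2]>0$ is the mean gain of the channel from the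 D2D source to the cellular user. Set $c_m=(-1)^{m+1}\binom{M}{m}$ and $$\beta_{\rm sr}=\left(\frac{d_0}{\sqrt{d^2+y^2}}\right)^\eta,\qquad \beta_{\rm rd}=\left(\frac{d_0}{\sqrt{(d_{\rm sd}-d)^2+y^2}}\right)^\eta .$$ The (approximate) average signal-to-interference-noise ratio at the D2D receiver is $$\widehat\Gamma_{\rm d}(P_{\rm s},d)=\frac{2P_{\rm s}d_0^{\eta}}{P_{\rm b}d_{\rm sd}^{\eta}}\left(1+\frac{N\alpha\pi\sqrt{\pi d_{\rm sd}^{\eta}\beta_{\rm sr}\beta_{\rm rd}}}{4\sqrt{d_0^{\eta}}}+\frac{N^2\alpha^2d_{\rm sd}^{\eta}\beta_{\rm sr}\beta_{\rm rd}}{d_0^{\eta}}\right)\frac{\sum_{m=1}^M\frac{c_m e^{mN_0/(P_{\rm b}\beta_{\rm bd})}}{(m/\beta_{\rm bd})^2}}{\left(\sum_{m=1}^M\frac{c_m e^{mN_0/(P_{\rm b}\beta_{\rm bd})}}{m/\beta_{\rm bd}}\right)^3}.$$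
   Formalization: For even M with N_0 > P_b β_bd ln 2, the last factor of the average SINR (the ratio of sums over m) is additionally assumed positive; without this the claim fails, e.g. M=2, P_b=β_bd=1, N_0=ln 6 makes the SINR decrease in P_s. *)

theory Defs
  imports "HOL-Probability.Probability"
begin

definition beta_sr :: "real \<Rightarrow> real \<Rightarrow> real \<Rightarrow> real \<Rightarrow> real" where
  "beta_sr d0 \<eta> y d = (d0 / sqrt (d\<^sup>2 + y\<^sup>2)) powr \<eta>"

definition beta_rd :: "real \<Rightarrow> real \<Rightarrow> real \<Rightarrow> real \<Rightarrow> real \<Rightarrow> real" where
  "beta_rd d0 \<eta> dsd y d = (d0 / sqrt ((dsd - d)\<^sup>2 + y\<^sup>2)) powr \<eta>"

definition c_coeff :: "nat \<Rightarrow> nat \<Rightarrow> real" where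
  "c_coeff M m = (-1) ^ (m + 1) * real (M choose m)"

definition interference_factor :: "nat \<Rightarrow> real \<Rightarrow> real \<Rightarrow> real \<Rightarrow> real" where
  "interference_factor M N0 Pb \<beta>bd =
     (\<Sum>m=1..M. c_coeff M m * exp (real m * N0 / (Pb * \<beta>bd)) / (real m / \<beta>bd)\<^sup>2) /
     (\<Sum>m=1..M. c_coeff M m * exp (real m * N0 / (Pb * \<beta>bd)) / (real m / \<beta>bd)) ^ 3"

definition Gamma_d ::
  "real \<Rightarrow> real \<Rightarrow> real \<Rightarrow> real \<Rightarrow> nat \<Rightarrow> real \<Rightarrow> nat \<Rightarrow> real \<Rightarrow> real \<Rightarrow> real \<Rightarrow> real \<Rightarrow> real \<Rightarrow> real"
where
  "Gamma_d d0 \<eta> dsd y N \<alpha> M Pb N0 \<beta>bd Ps d =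
     2 * Ps * d0 powr \<eta> / (Pb * dsd powr \<eta>) *
     (1 + real N * \<alpha> * pi *
            sqrt (pi * dsd powr \<eta> * beta_sr d0 \<eta> y d * beta_rd d0 \<eta> dsd y d) /
            (4 * sqrt (d0 powr \<eta>))
        + (real N)\<^sup>2 * \<alpha>\<^sup>2 * dsd powr \<eta> * beta_sr d0 \<eta> y d * beta_rd d0 \<eta> dsd y d / d0 powr \<eta>) *
     interference_factor M N0 Pb \<beta>bd"

definition feasible_powers :: "real \<Rightarrow> real \<Rightarrow> real \<Rightarrow> real set" where
  "feasible_powers g Ith Pmax = {P. P * g \<le> Ith \<and> 0 \<le> P \<and> P \<le> Pmax}"

text \<open>
  The two sums in the factor approximate, up to constants, the second and first moments of the
  interference-plus-noise power.  For odd \<open>M\<close>, and for noise \<open>N0 \<le> ln 2 * Pb * \<beta>bd\<close>, the factor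
  is positive.  For even \<open>M\<close> and stronger noise the approximation can break down and turn
  negative, as in the example below, so that the approximate average SINR decreases in the source
  power; positivity is then a genuine assumption.
\<close>

lemma interference_factor_neg_example: "interference_factor 2 (ln 6) 1 1 < 0"
proof -
  have e: "exp (2 * ln 6) = (36::real)"
    using exp_of_nat_mult[of 2 "ln 6 :: real"] by simp
  show ?thesis
    by (simp add: interference_factor_def c_coeff_def numeral_2_eq_2[symmetric]
        sum.atLeast_Suc_atMost[of "Suc 0"] e)
qed

end

(* With t = exp (N0 / (Pb * beta_bd)), the two sums of the interference factor are, up to powers of
   beta_bd, A(t) = sum c_m t^m / m and B(t) = sum c_m t^m / m^2.  They vanish at 0, and
   t A'(t) = 1 - (1 - t)^M and t B'(t) = A(t).  Hence A and B are positive as long as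
   (1 - s)^M < 1 on (0, t), that is, for odd M or for t <= 2.  So the average SINR is a positive
   multiple of the source power, and the largest feasible power is the unique optimum. *)
theory Submission
  imports Defs
begin

text \<open>This is the binomial theorem for \<open>(1 - s) ^ M\<close>; the 1 on the right is its
  term for m = 0.\<close>

lemma sum_c_coeff_power: "(\<Sum>m=1..M. c_coeff M m * s ^ m) = 1 - (1 - s) ^ M"
proof -
  have "(1 - s) ^ M = (\<Sum>m\<le>M. real (M choose m) * (- s) ^ m)"
    using binomial_ring[of "- s" 1 M] by simp
  also have "\<dots> = (\<Sum>m=0..M. real (M choose m) * (- s) ^ m)"
    by (simp add: atMost_atLeast0)
  also have "\<dots> = 1 + (\<Sum>m=1..M. real (M choose m) * (- s) ^ m)"
    by (simp add: sum.atLeast_Suc_atMost)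
  also have "(\<Sum>m=1..M. real (M choose m) * (- s) ^ m) = - (\<Sum>m=1..M. c_coeff M m * s ^ m)"
    by (simp add: sum_negf[symmetric] c_coeff_def power_minus[of s] mult_ac)
  finally show ?thesis by simp
qed

text \<open>Each derivative cancels one factor m in the denominator. Writing
  \<open>s ^ (m - 1)\<close> as \<open>s ^ m / s\<close> gives back a sum of the same family, at the
  price of excluding 0.\<close>

lemma DERIV_sum_c_coeff:
  assumes "s \<noteq> 0"
  shows "((\<lambda>t. \<Sum>m=1..M. c_coeff M m * t ^ m / real m ^ Suc k) has_real_derivative
           (\<Sum>m=1..M. c_coeff M m * s ^ m / real m ^ k) / s) (at s)"
  unfolding sum_divide_distrib
proof (rule DERIV_sum)
  fix m assume m: "m \<in> {1..M}"
  have "((\<lambda>t. c_coeff M m * t ^ m / real m ^ Suc k) has_real_derivative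
          c_coeff M m * (real m * s ^ (m - Suc 0)) / real m ^ Suc k) (at s)"
    by (intro DERIV_cdivide DERIV_cmult DERIV_pow)
  also have "c_coeff M m * (real m * s ^ (m - Suc 0)) / real m ^ Suc k
      = c_coeff M m * s ^ m / real m ^ k / s"
    using m assms by (cases m) auto
  finally show "((\<lambda>t. c_coeff M m * t ^ m / real m ^ Suc k) has_real_derivative
               c_coeff M m * s ^ m / real m ^ k / s) (at s)" .
qed

lemma sum_c_coeff_pos_step:
  assumes "t > 0" and "\<And>s. 0 < s \<Longrightarrow> s < t \<Longrightarrow> (\<Sum>m=1..M. c_coeff M m * s ^ m / real m ^ k) > 0"
  shows "(\<Sum>m=1..M. c_coeff M m * t ^ m / real m ^ Suc k) > 0"
proof -
  let ?F = "\<lambda>t. \<Sum>m=1..M. c_coeff M m * t ^ m / real m ^ Suc k"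
  have "?F 0 < ?F t"
  \<comment> \<open>The open version is used because the derivative formula divides by
    \<open>s\<close>; at 0 continuity suffices.\<close>
  proof (rule DERIV_pos_imp_increasing_open[OF \<open>t > 0\<close>])
    fix s assume s: "0 < s" "s < t"
    with assms(2)[OF s] show "\<exists>y. DERIV ?F s :> y \<and> 0 < y"
      by (intro exI[of _ "(\<Sum>m=1..M. c_coeff M m * s ^ m / real m ^ k) / s"] conjI
            DERIV_sum_c_coeff) auto
  next
    show "continuous_on {0..t} ?F"
      by (intro continuous_intros) auto
  qed
  moreover have "?F 0 = 0"
    by (intro sum.neutral) (auto simp: power_0_left)
  ultimately show ?thesis by simp
qed

text \<open>For \<open>s < 2\<close> the base has absolute value below 1; otherwise it is negative
  and the exponent is odd.\<close>

lemma one_minus_power_less_one: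
  fixes s :: real
  assumes "s > 0" "M \<ge> 1" "odd M \<or> s < 2"
  shows "(1 - s) ^ M < 1"
proof (cases "s < 2")
  case True
  then have "\<bar>1 - s\<bar> ^ M < 1"
    using assms by (simp add: power_less_one_iff)
  then show ?thesis by (simp flip: power_abs)
next
  case False
  with assms have "(1 - s) ^ M \<le> 0"
    by (intro power_le_zero_eq[THEN iffD2]) auto
  then show ?thesis by simp
qed

text \<open>Each induction step integrates once more. Positivity is needed only strictly below
  \<open>t\<close>, so \<open>t = 2\<close> is still allowed although the base case needs
  \<open>s < 2\<close>.\<close>

lemma sum_c_coeff_pos:
  assumes "t > 0" "M \<ge> 1" "odd M \<or> t \<le> 2"
  shows "(\<Sum>m=1..M. c_coeff M m * t ^ m / real m ^ Suc k) > 0"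
  using assms(1,3)
proof (induction k arbitrary: t)
  case 0
  show ?case
  proof (rule sum_c_coeff_pos_step[OF \<open>t > 0\<close>])
    fix s assume "0 < s" "s < t"
    with 0 \<open>M \<ge> 1\<close> show "(\<Sum>m=1..M. c_coeff M m * s ^ m / real m ^ 0) > 0"
      using one_minus_power_less_one[of s M] by (auto simp: sum_c_coeff_power[simplified])
  qed
next
  case (Suc k)
  then show ?case by (intro sum_c_coeff_pos_step[OF Suc.prems(1)] Suc.IH) auto
qed

lemma interference_factor_pos:
  assumes "M \<ge> 1" "\<beta>bd > 0" "odd M \<or> N0 / (Pb * \<beta>bd) \<le> ln 2"
  shows "interference_factor M N0 Pb \<beta>bd > 0"
proof -
  define t where "t = exp (N0 / (Pb * \<beta>bd))"
  have t: "t > 0" "odd M \<or> t \<le> 2"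
    using assms(3) by (auto simp: t_def ln_ge_iff)
  have e: "exp (real m * N0 / (Pb * \<beta>bd)) = t ^ m" for m
    unfolding t_def by (simp flip: exp_of_nat_mult)
  \<comment> \<open>The powers of \<open>\<beta>bd\<close> are pulled out of the sums, leaving
    exponents of the form \<open>Suc k\<close> with k = 1 and k = 0.\<close>
  have "interference_factor M N0 Pb \<beta>bd =
    (\<beta>bd\<^sup>2 * (\<Sum>m=1..M. c_coeff M m * t ^ m / real m ^ Suc 1)) /
    (\<beta>bd * (\<Sum>m=1..M. c_coeff M m * t ^ m / real m ^ Suc 0)) ^ 3"
    unfolding interference_factor_def e sum_distrib_left
    by (simp add: power_divide mult_ac power2_eq_square)
  also have "\<dots> > 0"
    using sum_c_coeff_pos[OF t(1) \<open>M \<ge> 1\<close> t(2)] \<open>\<beta>bd > 0\<close>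
    by (intro divide_pos_pos mult_pos_pos zero_less_power) blast+
  finally show ?thesis .
qed

lemma Gamma_d_strict_mono:
  assumes "interference_factor M N0 Pb \<beta>bd > 0" "d0 > 0" "dsd > 0" "Pb > 0" "\<alpha> \<ge> 0"
  shows "strict_mono (\<lambda>Ps. Gamma_d d0 \<eta> dsd y N \<alpha> M Pb N0 \<beta>bd Ps d)"
proof -
  \<comment> \<open>\<open>K\<close> is the slope of a function linear in \<open>Ps\<close>. Since
    \<open>powr\<close> is never negative, the bracket is at least 1 for every \<open>d\<close>,
    even where a distance to the RIS is 0.\<close>
  define K where "K = Gamma_d d0 \<eta> dsd y N \<alpha> M Pb N0 \<beta>bd 1 d"
  have "K > 0"
    unfolding K_def Gamma_d_def using assms
    by (intro mult_pos_pos divide_pos_pos add_pos_nonneg)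
       (auto intro!: mult_nonneg_nonneg divide_nonneg_nonneg simp: beta_sr_def beta_rd_def)
  moreover have "Gamma_d d0 \<eta> dsd y N \<alpha> M Pb N0 \<beta>bd Ps d = Ps * K" for Ps
    by (simp add: K_def Gamma_d_def)
  ultimately show ?thesis by (simp add: strict_mono_def)
qed

lemma is_arg_max_strict_mono_Icc_iff:
  fixes f :: "'a::linorder \<Rightarrow> 'b::linorder"
  assumes "strict_mono f" "a \<le> b"
  shows "is_arg_max f (\<lambda>x. x \<in> {a..b}) x \<longleftrightarrow> x = b"
  using assms by (auto simp: is_arg_max_def strict_mono_less not_less intro: antisym)

lemma feasible_powers_eq:
  assumes "g > 0"
  shows "feasible_powers g Ith Pmax = {0..min Pmax (Ith / g)}"
  using assms by (auto simp: feasible_powers_def pos_le_divide_eq)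

text \<open>The last hypothesis covers exactly the case left open by
  \<open>interference_factor_pos\<close>; \<open>interference_factor_neg_example\<close> shows that
  the sign can fail there.\<close>

theorem mainTheorem7:
  fixes d0 \<eta> \<delta> y dsd \<alpha> Pb N0 \<beta>bd Pmax Ith :: real
    and N M :: nat
    and \<Omega> :: "'w measure" and hsc :: "'w \<Rightarrow> complex"
  assumes "N \<ge> 1" "M \<ge> 1"
    and "0 \<le> \<alpha>" "\<alpha> \<le> 1"
    and "d0 > 0" "\<eta> > 0" "\<delta> > 0" "dsd > 0" "Pb > 0" "N0 > 0" "\<beta>bd > 0" "Pmax > 0" "Ith > 0"
    and "0 \<le> y" "y \<le> \<delta>"
    and "prob_space \<Omega>" "hsc \<in> borel_measurable \<Omega>" "integrable \<Omega> (\<lambda>w. (cmod (hsc w))\<^sup>2)"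
    and "prob_space.expectation \<Omega> (\<lambda>w. (cmod (hsc w))\<^sup>2) > 0"
    and "even M \<Longrightarrow> N0 / (Pb * \<beta>bd) > ln 2 \<Longrightarrow> interference_factor M N0 Pb \<beta>bd > 0"
  shows "(\<forall>d. strict_mono_on {0..} (\<lambda>Ps. Gamma_d d0 \<eta> dsd y N \<alpha> M Pb N0 \<beta>bd Ps d)) \<and>
    (\<forall>d. sqrt (\<delta>\<^sup>2 - y\<^sup>2) \<le> d \<and> d \<le> dsd - sqrt (\<delta>\<^sup>2 - y\<^sup>2) \<longrightarrow>
      (let g = prob_space.expectation \<Omega> (\<lambda>w. (cmod (hsc w))\<^sup>2); Pub = Ith / g in
        \<forall>P. is_arg_max (\<lambda>Ps. Gamma_d d0 \<eta> dsd y N \<alpha> M Pb N0 \<beta>bd Ps d)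
              (\<lambda>Ps. Ps \<in> feasible_powers g Ith Pmax) P \<longleftrightarrow>
            P = min Pmax Pub))"
proof -
  have "interference_factor M N0 Pb \<beta>bd > 0"
    using interference_factor_pos[of M \<beta>bd N0 Pb] assms by force
  then have mono: "strict_mono (\<lambda>Ps. Gamma_d d0 \<eta> dsd y N \<alpha> M Pb N0 \<beta>bd Ps d)" for d
    using assms by (intro Gamma_d_strict_mono) auto
  define g where "g = prob_space.expectation \<Omega> (\<lambda>w. (cmod (hsc w))\<^sup>2)"
  have "g > 0" using assms by (simp add: g_def)
  \<comment> \<open>The feasible interval is nonempty, so its right endpoint is attained.\<close>
  moreover from this have "0 \<le> min Pmax (Ith / g)" using assms by simp
  ultimately show ?thesis
    unfolding g_def[symmetric] Let_def
    \<comment> \<open>The deleted rules would break up the interval and its bound before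
      \<open>is_arg_max_strict_mono_Icc_iff\<close> can match.\<close>
    using mono by (auto simp: feasible_powers_eq is_arg_max_strict_mono_Icc_iff
        simp del: atLeastAtMost_iff min.bounded_iff intro: monotone_on_subset)
qed

end
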